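(* Let $p \ge 0$ and let $\underline{d}, \overline{d} \in \mathbb{Z}^{p+1}$ be strictly increasing sequences with $\underline{d}_i \leq \overline{d}_i$ for $0 \leq i \leq p$. Then the Boij-Söderberg poset $\Pi_{\underline{d}, \overline{d}}$ is a bounded complete lattice.
   Context: For strictly increasing sequences $\underline{d}, \overline{d} \in \mathbb{Z}^{p+1}$ with $\underline{d}_i \leq \overline{d}_i$ for $0 \leq i \leq p$, the Boij-Söderberg poset $\Pi_{\underline{d},\overline{d}}$ is the set of strictly increasing sequences $d = (d_0,\dots,d_p) \in \mathbb{Z}^{p+1}$ such that $\underline{d}_i \leq d_i \leq \overline{d}_i$ for $0 \leq i \leq p$, with partial order $d \leq e$ if and only if $d_i \leq e_i$ for $0 \leq i \leq p$. A poset is bounded if it has a unique minimal element $\hat 0$ and a unique maximal element $\hat 1$ (least and greatest elements). It is a complete lattice if every subset has an infimum (meet) and a supremum (join) in the poset. *)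

theory Defs
  imports "HOL-Algebra.Complete_Lattice"
begin

(* An element (d_0, ..., d_p) of Z^(p+1) is the list of its p + 1 entries. *)

definition strict_seqs :: "nat \<Rightarrow> int list set" where
  "strict_seqs p = {d. length d = p + 1 \<and> sorted_wrt (<) d}"

definition seq_le :: "nat \<Rightarrow> int list \<Rightarrow> int list \<Rightarrow> bool" where
  "seq_le p d e \<longleftrightarrow> (\<forall>i\<le>p. d ! i \<le> e ! i)"

definition boij_soederberg_poset :: "nat \<Rightarrow> int list \<Rightarrow> int list \<Rightarrow> int list gorder" where
  "boij_soederberg_poset p dl du =
    \<lparr>carrier = {d \<in> strict_seqs p. seq_le p dl d \<and> seq_le p d du},
     eq = (=),
     le = seq_le p\<rparr>"

end

(* The greatest sequence is du, and the entrywise infimum of a nonempty subset is again strictly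
   increasing because the entries are integers: d_i + 1 \<le> d_j passes to the infimum. A partial order
   with a greatest element and infima of nonempty subsets is a complete lattice. *)

theory Submission
  imports Defs
begin

text \<open>The integers are only conditionally complete, so these infima carry meaning only for
  nonempty \<open>A\<close> whose entries are bounded below; the lemmas that follow supply what each
  of them needs.\<close>

definition seq_Inf :: "nat \<Rightarrow> int list set \<Rightarrow> int list" where
  "seq_Inf p A = map (\<lambda>i. INF d\<in>A. d ! i) [0..<p + 1]"

lemma nth_seq_Inf [simp]: "i \<le> p \<Longrightarrow> seq_Inf p A ! i = (INF d\<in>A. d ! i)"
  by (simp add: seq_Inf_def del: upt_Suc)

lemma seq_Inf_lower:
  assumes "\<And>d. d \<in> A \<Longrightarrow> seq_le p dl d" and "d \<in> A"
  shows "seq_le p (seq_Inf p A) d"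
proof -
  \<comment> \<open>The common lower bound \<open>dl\<close> bounds every coordinate of
    \<open>A\<close> from below, as \<open>cINF_lower\<close> requires over the integers.\<close>
  have "bdd_below ((\<lambda>d. d ! i) ` A)" if "i \<le> p" for i
    using assms(1) that by (intro bdd_belowI2[where m = "dl ! i"]) (auto simp: seq_le_def)
  with \<open>d \<in> A\<close> show ?thesis
    by (auto simp: seq_le_def intro: cINF_lower)
qed

lemma seq_Inf_greatest:
  assumes "A \<noteq> {}" and "\<And>d. d \<in> A \<Longrightarrow> seq_le p l d"
  shows "seq_le p l (seq_Inf p A)"
  using assms by (auto simp: seq_le_def intro!: cINF_greatest)

lemma seq_Inf_strict:
  assumes A: "A \<subseteq> strict_seqs p" "A \<noteq> {}" and lower: "\<And>d. d \<in> A \<Longrightarrow> seq_le p dl d"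
  shows "seq_Inf p A \<in> strict_seqs p"
proof -
  have "seq_Inf p A ! i < seq_Inf p A ! j" if "i < j" "j \<le> p" for i j
  proof -
    \<comment> \<open>The left side does not depend on \<open>d\<close>, so it is one lower bound
      for all entries at position \<open>j\<close>. Writing < as + 1 with \<le> is what keeps the
      inequality strict in the infimum.\<close>
    have "seq_Inf p A ! i + 1 \<le> d ! j" if d: "d \<in> A" for d
    proof -
      have "seq_Inf p A ! i \<le> d ! i"
        using seq_Inf_lower[OF lower d] \<open>i < j\<close> \<open>j \<le> p\<close> by (auto simp: seq_le_def simp del: nth_seq_Inf)
      moreover have "d ! i < d ! j"
        using A(1) d \<open>i < j\<close> \<open>j \<le> p\<close> by (auto simp: strict_seqs_def sorted_wrt_iff_nth_less)
      ultimately show ?thesis by linarith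
    qed
    then have "seq_Inf p A ! i + 1 \<le> (INF d\<in>A. d ! j)"
      using A(2) by (intro cINF_greatest)
    with \<open>j \<le> p\<close> show ?thesis by simp
  qed
  then show ?thesis
    by (auto simp: strict_seqs_def sorted_wrt_iff_nth_less seq_Inf_def simp del: upt_Suc)
qed

lemma seq_le_refl: "seq_le p d d"
  by (simp add: seq_le_def)

lemma seq_le_trans: "seq_le p a b \<Longrightarrow> seq_le p b c \<Longrightarrow> seq_le p a c"
  by (force simp: seq_le_def)

text \<open>\<open>seq_le\<close> sees only the indices up to \<open>p\<close>. Membership in
  \<open>strict_seqs\<close> fixes the length at \<open>p + 1\<close>, so agreement at these indices
  makes the lists equal.\<close>

lemma seq_le_antisym:
  assumes "seq_le p a b" "seq_le p b a" "a \<in> strict_seqs p" "b \<in> strict_seqs p"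
  shows "a = b"
  using assms by (intro nth_equalityI) (simp_all add: seq_le_def strict_seqs_def order_antisym)

lemma partial_order_boij_soederberg_poset: "partial_order (boij_soederberg_poset p dl du)"
  by unfold_locales
    (simp_all add: boij_soederberg_poset_def seq_le_refl seq_le_antisym, blast intro: seq_le_trans)

text \<open>Bottom and top are the supremum and the infimum of the empty set, so boundedness follows
  from completeness.\<close>

lemma (in complete_lattice) is_bounded_lattice: "bounded_lattice L"
  by unfold_locales

theorem proposition2p1:
  fixes p :: nat and dl du :: "int list"
  assumes "dl \<in> strict_seqs p"
    and "du \<in> strict_seqs p"
    and "seq_le p dl du"
  shows "bounded_lattice (boij_soederberg_poset p dl du) \<and>
         complete_lattice (boij_soederberg_poset p dl du)"
proof -
  let ?L = "boij_soederberg_poset p dl du"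
  have "complete_lattice ?L"
  proof (rule partial_order.complete_lattice_criterion1[OF partial_order_boij_soederberg_poset])
    have "greatest ?L du (carrier ?L)"
      using assms by (auto simp: greatest_def boij_soederberg_poset_def seq_le_refl)
    then show "\<exists>g. greatest ?L g (carrier ?L)" ..
  next
    fix A assume A: "A \<subseteq> carrier ?L" "A \<noteq> {}"
    then have strict: "A \<subseteq> strict_seqs p"
      and lower: "\<And>d. d \<in> A \<Longrightarrow> seq_le p dl d"
      and upper: "\<And>d. d \<in> A \<Longrightarrow> seq_le p d du"
      by (auto simp: boij_soederberg_poset_def)
    \<comment> \<open>Nonemptiness yields the upper bound: the infimum lies below the member
      \<open>a\<close>, which lies below \<open>du\<close>.\<close>
    obtain a where "a \<in> A" using A(2) by blast
    then have "seq_le p (seq_Inf p A) du"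
      by (intro seq_le_trans[OF seq_Inf_lower[OF lower] upper])
    then have carrier: "seq_Inf p A \<in> carrier ?L"
      using seq_Inf_strict[OF strict A(2) lower] seq_Inf_greatest[OF A(2) lower]
      by (simp add: boij_soederberg_poset_def)
    have "greatest ?L (seq_Inf p A) (Lower ?L A)"
    proof (rule greatest_LowerI)
      show "seq_Inf p A \<sqsubseteq>\<^bsub>?L\<^esub> d" if "d \<in> A" for d
        using seq_Inf_lower[OF lower that] by (simp add: boij_soederberg_poset_def)
      show "l \<sqsubseteq>\<^bsub>?L\<^esub> seq_Inf p A" if "l \<in> Lower ?L A" for l
      proof -
        \<comment> \<open>\<open>Lower\<close> compares \<open>l\<close> only with members of
          \<open>A\<close> in the carrier; since \<open>A\<close> lies in the carrier, this covers
          every \<open>d\<close> in \<open>A\<close>.\<close>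
        have "seq_le p l d" if "d \<in> A" for d
          using \<open>l \<in> Lower ?L A\<close> that A(1) by (auto simp: Lower_def boij_soederberg_poset_def)
        from seq_Inf_greatest[OF A(2) this] show ?thesis
          by (simp add: boij_soederberg_poset_def)
      qed
    qed (use A(1) carrier in auto)
    then show "\<exists>i. greatest ?L i (Lower ?L A)" ..
  qed
  then show ?thesis
    using complete_lattice.is_bounded_lattice by blast
qed

end
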